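(* Let $d,N,N_Q\in\mathbb{N}$, $s\in(0,1)$ and $u:[0,1)^d\to\mathbb{R}$. Suppose the transformed convolution kernel $\hat\Phi$ is computed by the quadrature formula $$\hat\Phi_k=\pi^{2s}(2N)^{-d}\sum_{i}\alpha_i\sum_{j\in{\mathcal I'}_{2N}^d}|j+x_i|^{2s}\,Y_d\!\left(\tfrac{\pi}{N}(j+x_i-k)\right),\qquad k\in{\mathcal I'}_{2N}^d,$$ using the uniform quadrature rule on $[0,1]^d$ with points $x_i=i/N_Q$, $i\in\{0,\dots,N_Q-1\}^d$, and weights $\alpha_i=1/N_Q^d$, and let $(-\Delta)^s_N u$ denote the sinc-fractional Laplacian evaluated with this kernel. Then, with $S=2N_Q$, for all $\kappa\in\{0,\dots,N-1\}^d$ and $x_\kappa=\kappa/N$, $$\big((-\Delta)^s_N u\big)(x_\kappa)=S^{-2s}\big((\widetilde{-\Delta})^s_{S,N}u\big)(x_\kappa).$$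
   Context: Index sets: for $M\in\mathbb{N}$ let $\mathcal I_M=\{0,\dots,M-1\}$ and, for even $M$, $\mathcal I'_M=\{-M/2,\dots,M/2-1\}$; $\mathcal I_M^d$, ${\mathcal I'}_M^d$ are $d$-fold Cartesian products (so ${\mathcal I'}_{2N}^d=\{-N,\dots,N-1\}^d$). For $k\in\mathcal I_N^d$ write $u_k=u(k/N)$. $|\cdot|$ is the Euclidean norm and $a\cdot b$ the Euclidean inner product. For $x\in\mathbb{R}^d$, $Y_d(x)=\sum_{j\in{\mathcal I'}_{2N}^d}e^{\mathrm i\,j\cdot x}=\prod_{l=1}^d\sum_{j=-N}^{N-1}e^{\mathrm i j x_l}$. Sinc-fractional Laplacian evaluated with a kernel: given $\hat\Phi=(\hat\Phi_k)_{k\in{\mathcal I'}_{2N}^d}$, let $\Phi^N$ be its inverse discrete Fourier transform of size $(2N)^d$, i.e. the array $(\Phi^N(K))_{K\in{\mathcal I'}_{2N}^d}$ given by $$\Phi^N(K)=\frac1{(2N)^d}\sum_{k\in{\mathcal I'}_{2N}^d}\hat\Phi_k\,e^{2\pi\mathrm i\,k\cdot K/(2N)},\qquad\text{equivalently}\quad \hat\Phi_k=\sum_{K\in{\mathcal I'}_{2N}^d}\Phi^N(K)\,e^{-2\pi\mathrm i\,k\cdot K/(2N)} .$$ Then for $\kappa\in\mathcal I_N^d$, $x_\kappa=\kappa/N$, $$\big((-\Delta)^s_N u\big)(x_\kappa)=\sum_{k\in\mathcal I_N^d}u_k\,\Phi^N(\kappa-k).$$ (The exact kernel is $\hat\Phi_k=\pi^{2s}(2N)^{-d}\int_{[-N,N]^d}|\omega|^{2s}Y_d(\frac{\pi}{N}(\omega-k))\,d\omega$;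 the formula in the claim applies a quadrature rule $(x_i,\alpha_i)$ of $[0,1]^d$ on each unit cube $j+[0,1]^d$.) Discretized scaled periodic fractional Laplacian: for $S\in\mathbb{N}$ with $SN$ even, extend $(u_k)_{k\in\mathcal I_N^d}$ by zero to $(\bar u_k)_{k\in\mathcal I_{SN}^d}$, let $\hat u_j=\sum_{k\in\mathcal I_{SN}^d}\bar u_k e^{-2\pi\mathrm i\,j\cdot k/(SN)}$, and for $\kappa\in\mathcal I_N^d$ define $$\big((\widetilde{-\Delta})^s_{S,N}u\big)(x_\kappa)=\frac1{(SN)^d}\sum_{j\in{\mathcal I'}_{SN}^d}|2\pi j|^{2s}\,\hat u_j\,e^{2\pi\mathrm i\,j\cdot\kappa/(SN)}=\frac{(2\pi)^{2s}}{(SN)^d}\sum_{k\in\mathcal I_N^d}u_k\sum_{j\in{\mathcal I'}_{SN}^d}|j|^{2s}e^{\frac{2\pi\mathrm i}{SN}j\cdot(\kappa-k)} .$$ *)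

theory Defs
  imports "HOL-Analysis.Analysis"
begin

text \<open>The dimension \<open>d\<close> is \<open>CARD('d)\<close>; multi-indices are integer vectors \<open>int ^ 'd\<close>. The value
  at a grid point \<open>x\<^sub>\<kappa> = \<kappa> / N\<close> of the two discrete operators below is written as a function
  of the multi-index \<open>\<kappa>\<close>.\<close>

definition rvec :: "int ^ 'd \<Rightarrow> real ^ 'd::finite" where
  "rvec k = (\<chi> l. real_of_int (k $ l))"

definition index_box :: "nat \<Rightarrow> (int ^ 'd::finite) set" where
  "index_box M = {k. \<forall>l. k $ l \<in> {0..<int M}}"

text \<open>Only meant for even \<open>M\<close>.\<close>

definition centered_index_box :: "nat \<Rightarrow> (int ^ 'd::finite) set" where
  "centered_index_box M = {k. \<forall>l. k $ l \<in> {- (int M div 2)..<int M div 2}}"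

lemma finite_vec_Collect:
  assumes "finite A"
  shows "finite {k :: 'a ^ 'd::finite. \<forall>l. k $ l \<in> A}"
proof (rule finite_subset)
  show "{k :: 'a ^ 'd. \<forall>l. k $ l \<in> A} \<subseteq> vec_lambda ` (UNIV \<rightarrow>\<^sub>E A)"
  proof
    fix k :: "'a ^ 'd"
    assume "k \<in> {k. \<forall>l. k $ l \<in> A}"
    then have "($) k \<in> UNIV \<rightarrow>\<^sub>E A" by auto
    then show "k \<in> vec_lambda ` (UNIV \<rightarrow>\<^sub>E A)"
      by (metis image_eqI vec_nth_inverse)
  qed
  show "finite (vec_lambda ` ((UNIV :: 'd set) \<rightarrow>\<^sub>E A))"
    using assms by (intro finite_imageI finite_PiE) auto
qed

lemma finite_index_box [simp]: "finite (index_box M)"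
  unfolding index_box_def by (rule finite_vec_Collect) simp

lemma finite_centered_index_box [simp]: "finite (centered_index_box M)"
  unfolding centered_index_box_def by (rule finite_vec_Collect) simp

text \<open>\<open>sample N u k\<close> is \<open>u\<^sub>k = u (k / N)\<close>.\<close>

definition sample :: "nat \<Rightarrow> (real ^ 'd \<Rightarrow> real) \<Rightarrow> int ^ 'd \<Rightarrow> real" where
  "sample N u k = u (rvec k /\<^sub>R real N)"

definition Yd :: "nat \<Rightarrow> real ^ 'd::finite \<Rightarrow> complex" where
  "Yd N x = (\<Sum>j\<in>centered_index_box (2 * N). exp (\<i> * of_real (rvec j \<bullet> x)))"

definition quad_kernel ::
  "nat \<Rightarrow> real \<Rightarrow> 'q set \<Rightarrow> ('q \<Rightarrow> real ^ 'd::finite) \<Rightarrow> ('q \<Rightarrow> real) \<Rightarrow> int ^ 'd \<Rightarrow> complex" where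
  "quad_kernel N s I x \<alpha> k =
     of_real (pi powr (2 * s) / real (2 * N) ^ CARD('d)) *
     (\<Sum>i\<in>I. of_real (\<alpha> i) *
        (\<Sum>j\<in>centered_index_box (2 * N).
           of_real (norm (rvec j + x i) powr (2 * s)) *
           Yd N ((pi / real N) *\<^sub>R (rvec j + x i - rvec k))))"

definition conv_kernel :: "nat \<Rightarrow> (int ^ 'd::finite \<Rightarrow> complex) \<Rightarrow> int ^ 'd \<Rightarrow> complex" where
  "conv_kernel N Phihat K =
     1 / of_nat (2 * N) ^ CARD('d) *
     (\<Sum>k\<in>centered_index_box (2 * N).
        Phihat k * exp (2 * of_real pi * \<i> * of_real (rvec k \<bullet> rvec K / real (2 * N))))"

definition sinc_frac_laplacian ::
  "nat \<Rightarrow> (int ^ 'd::finite \<Rightarrow> complex) \<Rightarrow> (real ^ 'd \<Rightarrow> real) \<Rightarrow> int ^ 'd \<Rightarrow> complex" where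
  "sinc_frac_laplacian N Phihat u \<kappa> =
     (\<Sum>k\<in>index_box N. of_real (sample N u k) * conv_kernel N Phihat (\<kappa> - k))"

definition sample_ext :: "nat \<Rightarrow> (real ^ 'd::finite \<Rightarrow> real) \<Rightarrow> int ^ 'd \<Rightarrow> real" where
  "sample_ext N u k = (if k \<in> index_box N then sample N u k else 0)"

definition ext_dft :: "nat \<Rightarrow> nat \<Rightarrow> (real ^ 'd::finite \<Rightarrow> real) \<Rightarrow> int ^ 'd \<Rightarrow> complex" where
  "ext_dft S N u j =
     (\<Sum>k\<in>index_box (S * N).
        of_real (sample_ext N u k) *
        exp (- 2 * of_real pi * \<i> * of_real (rvec j \<bullet> rvec k / real (S * N))))"

text \<open>Only meant for even \<open>S * N\<close>.\<close>

definition periodic_frac_laplacian ::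
  "nat \<Rightarrow> nat \<Rightarrow> real \<Rightarrow> (real ^ 'd::finite \<Rightarrow> real) \<Rightarrow> int ^ 'd \<Rightarrow> complex" where
  "periodic_frac_laplacian S N s u \<kappa> =
     1 / of_nat (S * N) ^ CARD('d) *
     (\<Sum>j\<in>centered_index_box (S * N).
        of_real (norm ((2 * pi) *\<^sub>R rvec j) powr (2 * s)) * ext_dft S N u j *
        exp (2 * of_real pi * \<i> * of_real (rvec j \<bullet> rvec \<kappa> / real (S * N))))"

end

theory Submission
  imports Defs
begin

text \<open>
  Both operators are discrete convolutions of the samples \<open>u\<^sub>k\<close> with a kernel evaluated at the
  differences \<open>\<kappa> - k\<close>, so it suffices to compare the two kernels at these differences.

  The reason why they agree is that the inverse discrete Fourier transform undoes the function
  \<open>Y\<^sub>d\<close>: \<open>Y\<^sub>d\<close> is a sum of characters, and by orthogonality of characters the transform of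
  \<open>k \<mapsto> Y\<^sub>d (\<pi>/N (\<omega> - k))\<close>, evaluated at \<open>K\<close>, is the single plane wave \<open>e\<^bsup>i\<pi> K\<cdot>\<omega>/N\<^esup>\<close>
  (\<open>sum_Yd_character\<close>). This holds for every real frequency \<open>\<omega>\<close>, but only for \<open>K\<close> in the
  centered box of side \<open>2N\<close>. The differences of two indices in \<open>{0..<N}\<^sup>d\<close> lie in this box;
  this is why the transform has size \<open>2N\<close> and not \<open>N\<close>. The sinc kernel is therefore, up to a
  constant, the quadrature sum of \<open>|\<omega>|\<^bsup>2s\<^esup> e\<^bsup>i\<pi> K\<cdot>\<omega>/N\<^esup>\<close> over the nodes \<open>\<omega> = j + x\<^sub>i\<close>,
  for any quadrature rule (\<open>conv_kernel_quad_kernel\<close>).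

  For the uniform rule with \<open>Q\<close> points per direction the nodes \<open>j + i/Q\<close> are exactly
  the points \<open>m/Q\<close> with \<open>m\<close> in the centered box of side \<open>2QN = SN\<close>, each
  taken once (\<open>sum_refined_box\<close>, by division with remainder by \<open>Q\<close> in each coordinate). The plane wave at \<open>m/Q\<close> is the character of the periodic problem of
  size \<open>SN\<close>, and the constants match because \<open>(\<pi>/Q)\<^bsup>2s\<^esup> = S\<^bsup>-2s\<^esup> (2\<pi>)\<^bsup>2s\<^esup>\<close>.
\<close>

section \<open>Characters and sums over boxes\<close>

text \<open>Both arguments are real vectors, because besides the characters of the discrete transforms
  also plane waves at the quadrature nodes occur, which are not integral.\<close>

definition character :: "nat \<Rightarrow> real ^ 'd::finite \<Rightarrow> real ^ 'd \<Rightarrow> complex" where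
  "character M x y = cis (2 * pi * (x \<bullet> y) / real M)"

lemma exp_eq_character:
  "exp (2 * of_real pi * \<i> * of_real (x \<bullet> y / real M)) = character M x y"
  by (simp add: character_def cis_conv_exp algebra_simps)

lemma exp_minus_eq_character:
  "exp (- 2 * of_real pi * \<i> * of_real (x \<bullet> y / real M)) = character M x (- y)"
  by (simp add: character_def cis_conv_exp algebra_simps)

lemma character_add_right: "character M x (y + z) = character M x y * character M x z"
  by (simp add: character_def cis_mult inner_add_right ring_distribs add_divide_distrib)

lemma rvec_diff: "rvec (a - b) = rvec a - rvec b"
  by (simp add: rvec_def vec_eq_iff)

lemma character_eq_prod:
  "character M x y = (\<Prod>l\<in>UNIV. cis (2 * pi * (x $ l * y $ l) / real M))"
proof -
  have "cis (\<Sum>l\<in>A. g l) = (\<Prod>l\<in>A. cis (g l))" if "finite A" for g :: "'a \<Rightarrow> real" and A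
    using that by (induction A) (auto simp: cis_mult[symmetric])
  then show ?thesis
    by (simp add: character_def inner_vec_def sum_distrib_left sum_divide_distrib)
qed

text \<open>Distributivity in the form that splits a sum over a \<open>d\<close>-dimensional box into \<open>d\<close>
  one-dimensional sums; vectors are identified with functions on the index type.\<close>

lemma sum_vec_prod_nth:
  fixes f :: "'d::finite \<Rightarrow> 'a \<Rightarrow> 'b::comm_semiring_1"
  assumes "finite A"
  shows "(\<Sum>k | \<forall>l. k $ l \<in> A. \<Prod>l\<in>UNIV. f l (k $ l)) = (\<Prod>l\<in>UNIV. \<Sum>a\<in>A. f l a)"
proof -
  have "(\<Prod>l\<in>UNIV. \<Sum>a\<in>A. f l a) = (\<Sum>g\<in>UNIV \<rightarrow>\<^sub>E A. \<Prod>l\<in>UNIV. f l (g l))"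
    using assms by (subst prod_sum_PiE) auto
  also have "\<dots> = (\<Sum>k | \<forall>l. k $ l \<in> A. \<Prod>l\<in>UNIV. f l (k $ l))"
    by (rule sum.reindex_bij_witness[where i = vec_nth and j = vec_lambda])
       (auto simp: PiE_def)
  finally show ?thesis by simp
qed

text \<open>A geometric sum over a full period of a root of unity. The bound on \<open>m\<close> makes \<open>m = 0\<close> the
  only multiple of \<open>2N\<close>, so that otherwise the root of unity differs from 1.\<close>

lemma sum_centered_cis:
  fixes m :: int
  assumes "N \<ge> 1" "\<bar>m\<bar> < 2 * int N"
  shows "(\<Sum>k\<in>{- int N..<int N}. cis (2 * pi * (of_int k * of_int m) / real (2 * N))) =
         (if m = 0 then of_nat (2 * N) else 0)"
proof (cases "m = 0")
  case False
  define z where "z = cis (2 * pi * of_int m / real (2 * N))"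
  have pow: "z ^ n = cis (2 * pi * (real n * of_int m) / real (2 * N))" for n
    unfolding z_def Complex.DeMoivre by (simp add: algebra_simps)
  have ne: "z \<noteq> 1"
  proof
    assume "z = 1"
    then obtain n :: int where "2 * pi * of_int m / real (2 * N) = of_int (2 * n) * pi"
      unfolding z_def cis_conv_exp exp_eq_1 by auto
    then have "real_of_int m = of_int (2 * int N * n)"
      using assms(1) by (simp add: field_simps)
    then have "m = 2 * int N * n" by (simp only: of_int_eq_iff)
    then have "2 * int N dvd m" by simp
    with assms(2) show False
      using dvd_imp_le_int[OF False] by force
  qed
  have "z ^ (2 * N) = 1"
  proof -
    have "2 * pi * (real (2 * N) * of_int m) / real (2 * N) = 2 * pi * of_int m"
      using assms(1) by simp
    then show ?thesis unfolding pow by simp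
  qed
  \<comment> \<open>The shift \<open>n = k + N\<close> makes the exponents natural numbers, at the price of a constant phase.\<close>
  have "(\<Sum>k\<in>{- int N..<int N}. cis (2 * pi * (of_int k * of_int m) / real (2 * N))) =
      (\<Sum>n<2 * N. cis (- 2 * pi * (N * of_int m) / real (2 * N)) * z ^ n)"
  proof (rule sum.reindex_bij_witness[where i = "\<lambda>n. int n - int N" and j = "\<lambda>k. nat (k + int N)"])
    fix k assume k: "k \<in> {- int N..<int N}"
    then have "real (nat (k + int N)) = of_int k + real N" by simp
    then show "cis (- 2 * pi * (N * of_int m) / real (2 * N)) * z ^ nat (k + int N) =
        cis (2 * pi * (of_int k * of_int m) / real (2 * N))"
      unfolding pow cis_mult
      by (intro arg_cong[where f = cis]) (simp add: ring_distribs add_divide_distrib)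
  qed auto
  also have "\<dots> = 0"
    using ne \<open>z ^ (2 * N) = 1\<close> by (simp add: sum_distrib_left[symmetric] geometric_sum)
  finally show ?thesis using False by simp
qed simp

lemma centered_index_box_double:
  "centered_index_box (2 * M) = {k. \<forall>l. k $ l \<in> {- int M..<int M}}"
  by (simp add: centered_index_box_def)

lemma character_orthogonality:
  fixes m :: "int ^ 'd::finite"
  assumes "N \<ge> 1" "\<And>l. \<bar>m $ l\<bar> < 2 * int N"
  shows "(\<Sum>k\<in>centered_index_box (2 * N). character (2 * N) (rvec k) (rvec m)) =
         (if m = 0 then of_nat (2 * N) ^ CARD('d) else 0)"
proof -
  have "(\<Sum>k\<in>centered_index_box (2 * N). character (2 * N) (rvec k) (rvec m)) =
     (\<Prod>l\<in>UNIV. \<Sum>a\<in>{- int N..<int N}. cis (2 * pi * (of_int a * of_int (m $ l)) / real (2 * N)))"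
    unfolding centered_index_box_double
    by (subst sum_vec_prod_nth[symmetric]) (simp_all add: character_eq_prod rvec_def)
  also have "\<dots> = (\<Prod>l\<in>(UNIV::'d set). if m $ l = 0 then of_nat (2 * N) else 0)"
    by (intro prod.cong refl sum_centered_cis assms)
  also have "\<dots> = (if m = 0 then of_nat (2 * N) ^ CARD('d) else 0)"
  proof (cases "m = 0")
    case False
    then obtain l where "m $ l \<noteq> 0" by (auto simp: vec_eq_iff)
    then have "(\<Prod>l\<in>(UNIV::'d set). if m $ l = 0 then of_nat (2 * N) else 0) = (0::complex)"
      by (intro prod_zero) auto
    with False show ?thesis by simp
  qed simp
  finally show ?thesis .
qed

section \<open>The kernel of the sinc-fractional Laplacian\<close>

lemma Yd_eq_character:
  "Yd N ((pi / real N) *\<^sub>R x) =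
    (\<Sum>j\<in>centered_index_box (2 * N). character (2 * N) (rvec j) x)"
  by (simp add: Yd_def character_def cis_conv_exp)

text \<open>Expanding \<open>Y\<^sub>d\<close> and collecting the factors that depend on \<open>k\<close> gives the characters
  of the differences \<open>K - j\<close>, whose coordinates are smaller than \<open>2N\<close> in absolute value. By
  orthogonality only the term \<open>j = K\<close> survives. The vector \<open>x\<close> is arbitrary: the sampled \<open>Y\<^sub>d\<close>
  reproduces plane waves of non-integral frequency without error.\<close>

lemma sum_Yd_character:
  fixes K :: "int ^ 'd::finite"
  assumes "N \<ge> 1" "K \<in> centered_index_box (2 * N)"
  shows "(\<Sum>k\<in>centered_index_box (2 * N).
           Yd N ((pi / real N) *\<^sub>R (x - rvec k)) * character (2 * N) (rvec k) (rvec K)) =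
         of_nat (2 * N) ^ CARD('d) * character (2 * N) (rvec K) x"
proof -
  let ?C = "centered_index_box (2 * N) :: (int ^ 'd) set"
  have "(\<Sum>k\<in>?C. Yd N ((pi / real N) *\<^sub>R (x - rvec k)) * character (2 * N) (rvec k) (rvec K)) =
     (\<Sum>k\<in>?C. \<Sum>j\<in>?C. character (2 * N) (rvec j) x * character (2 * N) (rvec k) (rvec (K - j)))"
  proof (intro sum.cong refl, unfold Yd_eq_character sum_distrib_right,
      intro sum.cong refl)
    fix k j :: "int ^ 'd"
    show "character (2 * N) (rvec j) (x - rvec k) * character (2 * N) (rvec k) (rvec K) =
      character (2 * N) (rvec j) x * character (2 * N) (rvec k) (rvec (K - j))"
      unfolding character_def cis_mult
      by (rule arg_cong[where f = cis])
         (simp add: rvec_diff inner_diff_right inner_commute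
            ring_distribs add_divide_distrib diff_divide_distrib)
  qed
  also have "\<dots> = (\<Sum>j\<in>?C. character (2 * N) (rvec j) x *
      (\<Sum>k\<in>?C. character (2 * N) (rvec k) (rvec (K - j))))"
    by (subst sum.swap) (simp add: sum_distrib_left)
  also have "\<dots> = (\<Sum>j\<in>?C. character (2 * N) (rvec j) x *
      (if K = j then of_nat (2 * N) ^ CARD('d) else 0))"
  proof (intro sum.cong refl)
    fix j :: "int ^ 'd" assume j: "j \<in> ?C"
    have "\<bar>(K - j) $ l\<bar> < 2 * int N" for l
      using assms(2) j unfolding centered_index_box_double mem_Collect_eq
      by (auto dest!: spec[of _ l])
    then show "character (2 * N) (rvec j) x *
        (\<Sum>k\<in>?C. character (2 * N) (rvec k) (rvec (K - j))) =
      character (2 * N) (rvec j) x * (if K = j then of_nat (2 * N) ^ CARD('d) else 0)"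
      by (subst character_orthogonality[OF assms(1)]) auto
  qed
  also have "\<dots> = of_nat (2 * N) ^ CARD('d) * character (2 * N) (rvec K) x"
    using assms(2) by (simp add: if_distrib[of "\<lambda>c. _ * c"] sum.delta' cong: if_cong)
  finally show ?thesis .
qed

text \<open>The factor \<open>(2N)\<^sup>d\<close> that orthogonality produces cancels the normalisation of the inverse
  transform, and the kernel no longer contains \<open>Y\<^sub>d\<close>.\<close>

lemma conv_kernel_quad_kernel:
  fixes K :: "int ^ 'd::finite" and x :: "'q \<Rightarrow> real ^ 'd"
  assumes "N \<ge> 1" "K \<in> centered_index_box (2 * N)"
  shows "conv_kernel N (quad_kernel N s I x \<alpha>) K =
    of_real (pi powr (2 * s) / real (2 * N) ^ CARD('d)) *
    (\<Sum>i\<in>I. of_real (\<alpha> i) *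
      (\<Sum>j\<in>centered_index_box (2 * N). of_real (norm (rvec j + x i) powr (2 * s)) *
         character (2 * N) (rvec K) (rvec j + x i)))"
proof -
  let ?C = "centered_index_box (2 * N) :: (int ^ 'd) set"
  let ?c = "of_real (pi powr (2 * s) / real (2 * N) ^ CARD('d)) :: complex"
  let ?w = "\<lambda>i j. of_real (\<alpha> i) * of_real (norm (rvec j + x i) powr (2 * s)) :: complex"
  have "(\<Sum>k\<in>?C. quad_kernel N s I x \<alpha> k * character (2 * N) (rvec k) (rvec K)) =
    (\<Sum>k\<in>?C. \<Sum>i\<in>I. \<Sum>j\<in>?C. ?c * ?w i j *
        (Yd N ((pi / real N) *\<^sub>R (rvec j + x i - rvec k)) * character (2 * N) (rvec k) (rvec K)))"
    unfolding quad_kernel_def sum_distrib_left sum_distrib_right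
    by (intro sum.cong refl) (simp only: mult.assoc)
  also have "\<dots> = (\<Sum>i\<in>I. \<Sum>j\<in>?C. \<Sum>k\<in>?C. ?c * ?w i j *
        (Yd N ((pi / real N) *\<^sub>R (rvec j + x i - rvec k)) * character (2 * N) (rvec k) (rvec K)))"
    by (rule trans[OF sum.swap], rule sum.cong[OF refl], rule sum.swap)
  also have "\<dots> = (\<Sum>i\<in>I. \<Sum>j\<in>?C. ?c * ?w i j *
        (of_nat (2 * N) ^ CARD('d) * character (2 * N) (rvec K) (rvec j + x i)))"
    unfolding sum_distrib_left[symmetric] sum_Yd_character[OF assms] ..
  finally show ?thesis
    using assms(1) unfolding conv_kernel_def exp_eq_character
    by (simp add: sum_distrib_left mult_ac)
qed

text \<open>Every \<open>m\<close> is uniquely \<open>Q j + i\<close> with \<open>0 \<le> i < Q\<close> in each coordinate, namely with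
  \<open>j = m div Q\<close> and \<open>i = m mod Q\<close>; since \<open>div\<close> rounds down for negative \<open>m\<close> too, the half-open box
  \<open>{-N..<N}\<^sup>d\<close> refines exactly to \<open>{-QN..<QN}\<^sup>d\<close>.\<close>

lemma sum_refined_box:
  fixes f :: "int ^ 'd::finite \<Rightarrow> 'b::comm_monoid_add"
  assumes "Q \<ge> 1"
  shows "(\<Sum>i\<in>index_box Q. \<Sum>j\<in>centered_index_box (2 * N). f (of_nat Q * j + i)) =
         (\<Sum>m\<in>centered_index_box (2 * (Q * N)). f m)"
proof -
  have lower: "- (int Q * int N) \<le> int Q * b + a" if "0 \<le> a" "- int N \<le> b" for a b
  proof -
    have "int Q * - int N \<le> int Q * b" using that by (intro mult_left_mono) auto
    with that show ?thesis by simp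
  qed
  have upper: "int Q * b + a < int Q * int N" if "a < int Q" "b < int N" for a b
  proof -
    have "int Q * (b + 1) \<le> int Q * int N" using that by (intro mult_left_mono) auto
    with that show ?thesis by (simp add: ring_distribs)
  qed
  have div_lower: "- int N \<le> a div int Q" if "- (int Q * int N) \<le> a" for a
  proof -
    have "int Q * - int N div int Q \<le> a div int Q"
      using that assms by (intro zdiv_mono1) auto
    then show ?thesis using assms by (subst (asm) nonzero_mult_div_cancel_left) auto
  qed
  have div_upper: "a div int Q < int N" if "a < int Q * int N" for a
  proof -
    have "int Q * (a div int Q) \<le> a"
      using assms mult_div_mod_eq[of "int Q" a] pos_mod_sign[of "int Q" a] by linarith
    with that have "int Q * (a div int Q) < int Q * int N" by linarith
    then show ?thesis using assms by simp
  qed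
  have "(\<Sum>i\<in>index_box Q. \<Sum>j\<in>centered_index_box (2 * N). f (of_nat Q * j + i)) =
    (\<Sum>(i, j)\<in>index_box Q \<times> centered_index_box (2 * N). f (of_nat Q * j + i))"
    by (simp add: sum.cartesian_product)
  also have "\<dots> = (\<Sum>m\<in>centered_index_box (2 * (Q * N)). f m)"
    using assms unfolding centered_index_box_double index_box_def
    by (intro sum.reindex_bij_witness[where
            i = "\<lambda>m. (\<chi> l. m $ l mod int Q, \<chi> l. m $ l div int Q)"
        and j = "\<lambda>(i, j). of_nat Q * j + i"])
       (auto simp: vec_eq_iff of_nat_index lower upper div_lower div_upper)
  finally show ?thesis .
qed

text \<open>The node \<open>j + i/Q\<close> is \<open>m/Q\<close> with \<open>m = Q j + i\<close>. The factor \<open>1/Q\<close> leaves the norm as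
  \<open>Q\<^bsup>-2s\<^esup>\<close>, whereas in the phase it enlarges the period from \<open>2N\<close> to \<open>2QN\<close>.\<close>

lemma conv_kernel_uniform:
  fixes K :: "int ^ 'd::finite"
  assumes "N \<ge> 1" "Q \<ge> 1" "K \<in> centered_index_box (2 * N)"
  shows "conv_kernel N (quad_kernel N s (index_box Q)
            (\<lambda>i::int ^ 'd. rvec i /\<^sub>R real Q) (\<lambda>i. 1 / real Q ^ CARD('d))) K =
    of_real ((pi / real Q) powr (2 * s) / real (2 * (Q * N)) ^ CARD('d)) *
    (\<Sum>m\<in>centered_index_box (2 * (Q * N)).
       of_real (norm (rvec m) powr (2 * s)) * character (2 * (Q * N)) (rvec m) (rvec K))"
proof -
  have node: "rvec j + rvec i /\<^sub>R real Q = rvec (of_nat Q * j + i) /\<^sub>R real Q" for i j :: "int ^ 'd"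
    using assms(2) by (simp add: rvec_def vec_eq_iff of_nat_index field_simps)
  have powr: "norm (y /\<^sub>R real Q) powr (2 * s) = norm y powr (2 * s) / real Q powr (2 * s)"
    for y :: "real ^ 'd"
  proof -
    have "norm (y /\<^sub>R real Q) = norm y / real Q" by (simp add: divide_inverse_commute)
    then show ?thesis by (simp add: powr_divide)
  qed
  have char: "character (2 * N) x (y /\<^sub>R real Q) = character (2 * (Q * N)) y x" for x y :: "real ^ 'd"
    unfolding character_def
    by (rule arg_cong[where f = cis]) (simp add: inner_commute[of x] field_simps)
  let ?a = "of_real (pi powr (2 * s) / real (2 * N) ^ CARD('d)) :: complex"
  let ?b = "of_real (1 / real Q ^ CARD('d)) :: complex"
  let ?c = "of_real (real Q powr (2 * s)) :: complex"
  let ?f = "\<lambda>m :: int ^ 'd. of_real (norm (rvec m) powr (2 * s)) *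
              character (2 * (Q * N)) (rvec m) (rvec K)"
  have "conv_kernel N (quad_kernel N s (index_box Q)
            (\<lambda>i::int ^ 'd. rvec i /\<^sub>R real Q) (\<lambda>i. 1 / real Q ^ CARD('d))) K =
      ?a * (\<Sum>i\<in>index_box Q. ?b * (\<Sum>j\<in>centered_index_box (2 * N). ?f (of_nat Q * j + i) / ?c))"
    unfolding conv_kernel_quad_kernel[OF assms(1,3)] node powr char by simp
  also have "\<dots> = ?a * (?b * ((\<Sum>m\<in>centered_index_box (2 * (Q * N)). ?f m) / ?c))"
    unfolding sum_refined_box[OF assms(2), symmetric] by (simp only: sum_distrib_left sum_divide_distrib)
  also have "?a * (?b * (F / ?c)) =
      of_real ((pi / real Q) powr (2 * s) / real (2 * (Q * N)) ^ CARD('d)) * F" for F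
    by (simp add: powr_divide power_mult_distrib)
  finally show ?thesis .
qed

section \<open>The periodic operator as a convolution\<close>

lemma ext_dft_eq:
  assumes "S \<ge> 1"
  shows "ext_dft S N u j =
    (\<Sum>k\<in>index_box N. of_real (sample N u k) * character (S * N) (rvec j) (- rvec k))"
proof -
  have "int N \<le> int (S * N)" using assms by (cases S) auto
  then have "index_box N \<subseteq> index_box (S * N)"
    unfolding index_box_def atLeastLessThan_iff by (blast intro: less_le_trans)
  then show ?thesis
    unfolding ext_dft_def exp_minus_eq_character
    by (intro sum.mono_neutral_cong_right) (auto simp: sample_ext_def)
qed

lemma periodic_frac_laplacian_convolution:
  fixes u :: "real ^ 'd::finite \<Rightarrow> real"
  assumes "S \<ge> 1"
  shows "periodic_frac_laplacian S N s u \<kappa> =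
    (\<Sum>k\<in>index_box N. of_real (sample N u k) *
      (of_real ((2 * pi) powr (2 * s) / real (S * N) ^ CARD('d)) *
       (\<Sum>j\<in>centered_index_box (S * N). of_real (norm (rvec j) powr (2 * s)) *
          character (S * N) (rvec j) (rvec (\<kappa> - k)))))"
proof -
  have powr: "norm ((2 * pi) *\<^sub>R y) powr (2 * s) = (2 * pi) powr (2 * s) * norm y powr (2 * s)"
    for y :: "real ^ 'd"
    by (simp add: powr_mult)
  have char: "character (S * N) y (rvec (\<kappa> - k)) =
      character (S * N) y (- rvec k) * character (S * N) y (rvec \<kappa>)" for y k
    by (simp add: rvec_diff flip: character_add_right)
  show ?thesis
    unfolding periodic_frac_laplacian_def exp_eq_character ext_dft_eq[OF assms] powr char
      sum_distrib_left sum_distrib_right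
    by (subst sum.swap) (simp add: mult_ac)
qed

section \<open>Equality of the two operators\<close>

theorem theorem3p2:
  fixes N NQ S :: nat and s :: real
    and u :: "real ^ 'd::finite \<Rightarrow> real"
    and Phihat :: "int ^ 'd \<Rightarrow> complex"
  assumes "N \<ge> 1" and "NQ \<ge> 1" and "0 < s" and "s < 1"
    and "\<And>k. k \<in> centered_index_box (2 * N) \<Longrightarrow>
           Phihat k = quad_kernel N s (index_box NQ)
             (\<lambda>i::int ^ 'd. rvec i /\<^sub>R real NQ) (\<lambda>i. 1 / real NQ ^ CARD('d)) k"
    and "S = 2 * NQ"
  shows "\<forall>\<kappa>\<in>index_box N.
           sinc_frac_laplacian N Phihat u \<kappa> =
           of_real (real S powr (- 2 * s)) * periodic_frac_laplacian S N s u \<kappa>"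
proof
  fix \<kappa> :: "int ^ 'd" assume \<kappa>: "\<kappa> \<in> index_box N"
  let ?Q = "quad_kernel N s (index_box NQ)
             (\<lambda>i::int ^ 'd. rvec i /\<^sub>R real NQ) (\<lambda>i. 1 / real NQ ^ CARD('d))"
  have SN: "S * N = 2 * (NQ * N)" and S: "S \<ge> 1" using assms by simp_all
  have scale: "(pi / real NQ) powr (2 * s) = real S powr (- 2 * s) * (2 * pi) powr (2 * s)"
    using assms(2) by (simp add: \<open>S = 2 * NQ\<close> powr_divide powr_mult powr_minus field_simps)
  have "conv_kernel N Phihat (\<kappa> - k) =
      of_real (real S powr (- 2 * s)) *
      (of_real ((2 * pi) powr (2 * s) / real (S * N) ^ CARD('d)) *
       (\<Sum>j\<in>centered_index_box (S * N). of_real (norm (rvec j) powr (2 * s)) *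
          character (S * N) (rvec j) (rvec (\<kappa> - k))))"
    if k: "k \<in> index_box N" for k
  proof -
    have K: "\<kappa> - k \<in> centered_index_box (2 * N)"
      unfolding centered_index_box_double mem_Collect_eq
    proof
      fix l
      show "(\<kappa> - k) $ l \<in> {- int N..<int N}"
        using \<kappa> k unfolding index_box_def by (auto dest!: spec[of _ l])
    qed
    have "conv_kernel N Phihat (\<kappa> - k) = conv_kernel N ?Q (\<kappa> - k)"
      unfolding conv_kernel_def using assms(5) by simp
    then show ?thesis
      unfolding conv_kernel_uniform[OF assms(1,2) K] scale SN by (simp add: mult_ac)
  qed
  then show "sinc_frac_laplacian N Phihat u \<kappa> =
      of_real (real S powr (- 2 * s)) * periodic_frac_laplacian S N s u \<kappa>"
    unfolding sinc_frac_laplacian_def periodic_frac_laplacian_convolution[OF S]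
      sum_distrib_left[of "of_real (real S powr _)"]
    by (intro sum.cong refl) (simp only: mult.left_commute)
qed

end
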